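(* Let $X$ be an Archimedean and directed partially ordered vector space that contains net catching elements. Then for every net $(x_\alpha)_{\alpha\in A}$ in $X$ and every $x\in X$ we have $x_\alpha\xrightarrow{o}x$ if and only if $x_\alpha\xrightarrow{\tau_o}x$ (convergence with respect to the order topology $\tau_o$).
   Context: A partially ordered vector space is a real vector space $X$ with a partial order $\leq$ such that $x\leq y$ implies $x+z\leq y+z$ and $\lambda x\leq\lambda y$ for all $z\in X$ and real $\lambda\geq 0$; $[x,y]=\{z\in X;\ x\leq z\leq y\}$. $X$ is Archimedean if for all $x,y\in X$ with $nx\leq y$ for all $n\in\mathbb{N}$ one has $x\leq 0$; $X$ is directed if any two elements have a common upper bound. For a net $(x_\alpha)_{\alpha\in A}$ in $X$ we write $x_\alpha\downarrow 0$ if the net is decreasing ($\alpha\leq\beta$ implies $x_\beta\leq x_\alpha$) and $\inf_{\alpha\in A} x_\alpha=0$. Order convergence: $x_\alpha\xrightarrow{o}x$ if there are a net $(\check{x}_\beta)_{\beta\in B}$ in $X$ (with a possibly different index set $B$) and a map $\eta\colon B\to A$ such that $\check{x}_\beta\downarrow 0$ and $\pm(x_\alpha-x)\leq\check{x}_\beta$ for every $\beta\in B$ and $\alpha\in A$ with $\alpha\geq\eta(\beta)$. A set $M\subseteq X$ is net catching for $x\in X$ if for every net $(x_\alpha)_{\alpha\in A}$ in $X$ with $x_\alpha\downarrow 0$ there is $\alpha\in A$ with $[x-x_\alpha,x+x_\alpha]\subseteq M$. A set $O\subseteq X$ is order open if it is net catching for every $x\in O$. The order topology is $\tau_o=\{O\subseteq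 X;\ O\text{ order open}\}$. An element $y\in X$ is called net catching if for every net $(x_\alpha)_{\alpha\in A}$ in $X$ with $x_\alpha\downarrow 0$ there is $\alpha\in A$ with $x_\alpha\leq y$. *)

theory Defs
  imports "HOL-Analysis.Analysis"
begin

text \<open>
  A partially ordered vector space is a type of class \<^class>\<open>ordered_real_vector\<close>.
  A net is a family indexed by a directed set, given as a carrier \<open>A\<close> of an arbitrary
  index type with a preorder \<open>r\<close> on it; \<open>(a, b) \<in> r\<close> reads \<open>a \<le> b\<close>.
\<close>

definition directed_index :: "'i set \<Rightarrow> 'i rel \<Rightarrow> bool" where
  "directed_index A r \<longleftrightarrow>
     A \<noteq> {} \<and> preorder_on A r \<and> (\<forall>a\<in>A. \<forall>b\<in>A. \<exists>c\<in>A. (a, c) \<in> r \<and> (b, c) \<in> r)"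

definition decreases_to_zero ::
  "'i set \<Rightarrow> 'i rel \<Rightarrow> ('i \<Rightarrow> 'a::ordered_real_vector) \<Rightarrow> bool" where
  "decreases_to_zero A r x \<longleftrightarrow>
     directed_index A r \<and>
     (\<forall>(a, b)\<in>r. x b \<le> x a) \<and>
     (\<forall>a\<in>A. 0 \<le> x a) \<and> (\<forall>z. (\<forall>a\<in>A. z \<le> x a) \<longrightarrow> z \<le> 0)"

text \<open>
  HOL cannot quantify over index types inside a definition. The three definitions below
  therefore take the auxiliary decreasing nets to be indexed by directed preordered subsets
  of the type \<open>'a\<close> itself. This loses nothing: the lemmas \<open>net_catching_any_index\<close>,
  \<open>net_catching_element_any_index\<close> and \<open>order_convergesI_any_index\<close> show that
  the notions agree with those obtained from nets over an arbitrary index type, since a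
  decreasing net may be replaced by its range with the reversed order.
\<close>

definition order_converges ::
  "'i set \<Rightarrow> 'i rel \<Rightarrow> ('i \<Rightarrow> 'a::ordered_real_vector) \<Rightarrow> 'a \<Rightarrow> bool" where
  "order_converges A r x l \<longleftrightarrow>
     (\<exists>(B :: 'a set) s (y :: 'a \<Rightarrow> 'a) \<eta>.
        decreases_to_zero B s y \<and> \<eta> ` B \<subseteq> A \<and>
        (\<forall>b\<in>B. \<forall>a\<in>A. (\<eta> b, a) \<in> r \<longrightarrow> x a - l \<le> y b \<and> - (x a - l) \<le> y b))"

definition net_catching_for :: "'a::ordered_real_vector set \<Rightarrow> 'a \<Rightarrow> bool" where
  "net_catching_for M x \<longleftrightarrow>
     (\<forall>(A :: 'a set) r (u :: 'a \<Rightarrow> 'a).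
        decreases_to_zero A r u \<longrightarrow> (\<exists>a\<in>A. {x - u a .. x + u a} \<subseteq> M))"

definition net_catching_element :: "'a::ordered_real_vector \<Rightarrow> bool" where
  "net_catching_element y \<longleftrightarrow>
     (\<forall>(A :: 'a set) r (u :: 'a \<Rightarrow> 'a).
        decreases_to_zero A r u \<longrightarrow> (\<exists>a\<in>A. u a \<le> y))"

definition order_open :: "'a::ordered_real_vector set \<Rightarrow> bool" where
  "order_open M \<longleftrightarrow> (\<forall>x\<in>M. net_catching_for M x)"

definition tau_o :: "'a::ordered_real_vector topology" where
  "tau_o = topology order_open"

definition tails :: "'i set \<Rightarrow> 'i rel \<Rightarrow> 'i filter" where
  "tails A r = (INF a\<in>A. principal {b \<in> A. (a, b) \<in> r})"

lemma eventually_tails: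
  assumes "directed_index A r"
  shows "eventually P (tails A r) \<longleftrightarrow> (\<exists>a\<in>A. \<forall>b\<in>A. (a, b) \<in> r \<longrightarrow> P b)"
proof -
  have "\<exists>c\<in>A. principal {d \<in> A. (c, d) \<in> r}
          \<le> inf (principal {d \<in> A. (a, d) \<in> r}) (principal {d \<in> A. (b, d) \<in> r})"
    if ab: "a \<in> A" "b \<in> A" for a b
  proof -
    obtain c where "c \<in> A" "(a, c) \<in> r" "(b, c) \<in> r"
      using assms ab unfolding directed_index_def by blast
    moreover have "trans r"
      using assms by (simp add: directed_index_def preorder_on_def)
    ultimately show ?thesis
      by (auto intro!: bexI[of _ c] dest: transD)
  qed
  moreover have "A \<noteq> {}"
    using assms by (simp add: directed_index_def)
  ultimately show ?thesis
    unfolding tails_def by (subst eventually_INF_base) (auto simp: eventually_principal)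
qed

lemma decreases_to_zero_range:
  assumes "decreases_to_zero A r x"
  shows "decreases_to_zero (x ` A) {(p, q). p \<in> x ` A \<and> q \<in> x ` A \<and> q \<le> p} (\<lambda>p. p)"
proof -
  have dir: "\<exists>c\<in>A. x c \<le> x a \<and> x c \<le> x b" if "a \<in> A" "b \<in> A" for a b
    using assms that unfolding decreases_to_zero_def directed_index_def by blast
  have "preorder_on (x ` A) {(p, q). p \<in> x ` A \<and> q \<in> x ` A \<and> q \<le> p}"
    unfolding preorder_on_def refl_on_def trans_def by auto
  moreover have "A \<noteq> {}" "\<forall>a\<in>A. 0 \<le> x a" "\<forall>z. (\<forall>a\<in>A. z \<le> x a) \<longrightarrow> z \<le> 0"
    using assms by (auto simp: decreases_to_zero_def directed_index_def)
  ultimately show ?thesis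
    using dir unfolding decreases_to_zero_def directed_index_def by simp
qed

lemma net_catching_any_index:
  fixes u :: "'i \<Rightarrow> 'a::ordered_real_vector"
  assumes "net_catching_for M x" "decreases_to_zero A r u"
  shows "\<exists>a\<in>A. {x - u a .. x + u a} \<subseteq> M"
  using assms(1) decreases_to_zero_range[OF assms(2)] unfolding net_catching_for_def by blast

lemma net_catching_element_any_index:
  fixes u :: "'i \<Rightarrow> 'a::ordered_real_vector"
  assumes "net_catching_element y" "decreases_to_zero A r u"
  shows "\<exists>a\<in>A. u a \<le> y"
  using assms(1) decreases_to_zero_range[OF assms(2)] unfolding net_catching_element_def by blast

lemma order_convergesI_any_index:
  fixes x :: "'i \<Rightarrow> 'a::ordered_real_vector" and y :: "'j \<Rightarrow> 'a"
  assumes y: "decreases_to_zero B s y" and \<eta>: "\<eta> ` B \<subseteq> A"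
    and bnd: "\<forall>b\<in>B. \<forall>a\<in>A. (\<eta> b, a) \<in> r \<longrightarrow> x a - l \<le> y b \<and> - (x a - l) \<le> y b"
  shows "order_converges A r x l"
proof -
  define \<theta> where "\<theta> p = \<eta> (inv_into B y p)" for p
  have inv: "inv_into B y p \<in> B" "y (inv_into B y p) = p" if "p \<in> y ` B" for p
    using that by (auto intro: inv_into_into f_inv_into_f)
  have "\<theta> ` (y ` B) \<subseteq> A"
    using \<eta> inv unfolding \<theta>_def by blast
  moreover have "\<forall>p\<in>y ` B. \<forall>a\<in>A. (\<theta> p, a) \<in> r \<longrightarrow> x a - l \<le> p \<and> - (x a - l) \<le> p"
    using bnd inv unfolding \<theta>_def by metis
  ultimately show ?thesis
    using decreases_to_zero_range[OF y] unfolding order_converges_def by blast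
qed

lemma istopology_order_open: "istopology order_open"
  unfolding istopology_def
proof (intro conjI allI impI)
  fix S T :: "'a set"
  assume ST: "order_open S" "order_open T"
  show "order_open (S \<inter> T)"
    unfolding order_open_def net_catching_for_def
  proof (intro ballI allI impI)
    fix x :: 'a and A :: "'a set" and r and u :: "'a \<Rightarrow> 'a"
    assume x: "x \<in> S \<inter> T" and u: "decreases_to_zero A r u"
    obtain a where a: "a \<in> A" "{x - u a .. x + u a} \<subseteq> S"
      using ST(1) x u unfolding order_open_def net_catching_for_def by blast
    obtain b where b: "b \<in> A" "{x - u b .. x + u b} \<subseteq> T"
      using ST(2) x u unfolding order_open_def net_catching_for_def by blast
    obtain c where c: "c \<in> A" "u c \<le> u a" "u c \<le> u b"
      using u a(1) b(1) unfolding decreases_to_zero_def directed_index_def by blast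
    have "{x - u c .. x + u c} \<subseteq> {x - u a .. x + u a}"
      "{x - u c .. x + u c} \<subseteq> {x - u b .. x + u b}"
      using c by (auto intro!: diff_mono add_mono)
    then show "\<exists>a\<in>A. {x - u a .. x + u a} \<subseteq> S \<inter> T"
      using a b c by blast
  qed
next
  fix K :: "'a set set"
  assume "\<forall>S\<in>K. order_open S"
  then show "order_open (\<Union>K)"
    unfolding order_open_def net_catching_for_def by (meson UnionE Sup_upper subset_trans)
qed

lemma openin_tau_o [simp]: "openin tau_o = order_open"
  by (simp add: tau_o_def istopology_order_open)

lemma topspace_tau_o [simp]: "topspace tau_o = UNIV"
proof -
  have "order_open (UNIV :: 'a set)"
    unfolding order_open_def net_catching_for_def decreases_to_zero_def directed_index_def by auto
  then have "openin tau_o (UNIV :: 'a set)"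
    by simp
  then show ?thesis
    using openin_subset by blast
qed

end

theory Submission
  imports Defs
begin

text \<open>
  A net catching element \<open>y\<close> is positive, and the sets of all \<open>z\<close> with
  \<open>\<plusminus>(z - l) \<le> \<delta> y\<close> for some \<open>\<delta> < \<epsilon>\<close> are order open: if
  \<open>u\<^sub>a \<down> 0\<close> then also \<open>c u\<^sub>a \<down> 0\<close>, so that some \<open>u\<^sub>a\<close> lies below \<open>y / c\<close> for any prescribed
  \<open>c > 0\<close>. A net that converges to \<open>l\<close> in the order topology is therefore eventually
  within \<open>y / (n + 1)\<close> of \<open>l\<close> for every \<open>n\<close>, and \<open>y / (n + 1) \<down> 0\<close> by the Archimedean property.
\<close>

lemma decreases_to_zero_scaleR:
  assumes u: "decreases_to_zero A r u" and c: "0 < c"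
  shows "decreases_to_zero A r (\<lambda>a. c *\<^sub>R u a)"
  unfolding decreases_to_zero_def
proof (intro conjI allI impI)
  show "directed_index A r" "\<forall>(a, b)\<in>r. c *\<^sub>R u b \<le> c *\<^sub>R u a" "\<forall>a\<in>A. 0 \<le> c *\<^sub>R u a"
    using u c by (auto simp: decreases_to_zero_def intro!: scaleR_left_mono scaleR_nonneg_nonneg)
next
  fix z assume "\<forall>a\<in>A. z \<le> c *\<^sub>R u a"
  then have "\<forall>a\<in>A. z /\<^sub>R c \<le> u a"
    using c by (simp add: pos_divideR_le_eq)
  then have "z /\<^sub>R c \<le> 0"
    using u by (simp add: decreases_to_zero_def)
  then show "z \<le> 0"
    using c by (simp add: pos_divideR_le_eq)
qed

text \<open>The shift to \<open>Suc n\<close> matters: since \<open>inverse 0 = 0\<close>, starting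
  the divisors at 0 would put the value 0 first and, for nonzero \<open>y\<close>, destroy
  monotonicity.\<close>

lemma decreases_to_zero_inverse_Suc:
  fixes y :: "'a::ordered_real_vector"
  assumes archimedean: "\<forall>u v :: 'a. (\<forall>n::nat. real n *\<^sub>R u \<le> v) \<longrightarrow> u \<le> 0"
    and y: "0 \<le> y"
  shows "decreases_to_zero UNIV {(m, n). m \<le> n} (\<lambda>n::nat. y /\<^sub>R real (Suc n))"
  unfolding decreases_to_zero_def
proof (intro conjI allI impI)
  have "preorder_on UNIV {(m::nat, n). m \<le> n}"
    by (auto simp: preorder_on_def refl_on_def trans_def)
  then show "directed_index UNIV {(m::nat, n). m \<le> n}"
    by (auto simp: directed_index_def intro: max.cobounded1 max.cobounded2)
  show "\<forall>(m, n)\<in>{(m, n). m \<le> n}. y /\<^sub>R real (Suc n) \<le> y /\<^sub>R real (Suc m)"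
    using y by (auto intro!: scaleR_right_mono le_imp_inverse_le)
  show "\<forall>n\<in>UNIV. 0 \<le> y /\<^sub>R real (Suc n)"
    using y by (auto intro!: scaleR_nonneg_nonneg)
next
  fix z assume z: "\<forall>n\<in>UNIV. z \<le> y /\<^sub>R real (Suc n)"
  have "real n *\<^sub>R z \<le> y" for n
  \<comment> \<open>For \<open>n = 0\<close> the claim is \<open>0 \<le> y\<close>; for
    \<open>n = Suc m\<close> it is the lower bound at index \<open>m\<close> multiplied by
    \<open>Suc m\<close>.\<close>
  proof (cases n)
    case (Suc m)
    then show ?thesis
      using z pos_le_divideR_eq[of "real (Suc m)" z y] by simp
  qed (use y in simp)
  then show "z \<le> 0"
    using archimedean by blast
qed

lemma net_catching_element_nonneg:
  assumes "net_catching_element y"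
  shows "0 \<le> y"
proof -
  \<comment> \<open>A one-point net with value 0 has only one term to catch, and catching it forces
    \<open>0 \<le> y\<close>.\<close>
  have "decreases_to_zero {()} {((), ())} (\<lambda>_. 0 :: 'a)"
    by (auto simp: decreases_to_zero_def directed_index_def preorder_on_def refl_on_def trans_def)
  then show ?thesis
    using net_catching_element_any_index[OF assms] by blast
qed

lemma net_catching_element_scaleR:
  assumes y: "net_catching_element y" and c: "0 < c"
  shows "net_catching_element (c *\<^sub>R y)"
  unfolding net_catching_element_def
proof (intro allI impI)
  fix A :: "'a set" and r and u :: "'a \<Rightarrow> 'a"
  assume "decreases_to_zero A r u"
  then have "decreases_to_zero A r (\<lambda>a. inverse c *\<^sub>R u a)"
    using c by (simp add: decreases_to_zero_scaleR)
  then obtain a where "a \<in> A" "u a /\<^sub>R c \<le> y"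
    using y unfolding net_catching_element_def by blast
  then show "\<exists>a\<in>A. u a \<le> c *\<^sub>R y"
    using c by (auto simp: pos_divideR_le_eq)
qed

text \<open>The strict bound on \<delta> leaves each point a gap below \<epsilon>. A term of the net
  below half of this gap times \<open>y\<close> moves the point by too little to use the gap
  up.\<close>

lemma order_open_ball:
  assumes y: "net_catching_element y"
  shows "order_open {z. \<exists>\<delta><\<epsilon>. z - l \<le> \<delta> *\<^sub>R y \<and> - (z - l) \<le> \<delta> *\<^sub>R y}" (is "order_open ?O")
  unfolding order_open_def net_catching_for_def
proof (intro ballI allI impI)
  fix z A r and u :: "'a \<Rightarrow> 'a"
  assume "z \<in> ?O" and u: "decreases_to_zero A r u"
  then obtain \<delta> where \<delta>: "\<delta> < \<epsilon>" "z - l \<le> \<delta> *\<^sub>R y" "- (z - l) \<le> \<delta> *\<^sub>R y"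
    by blast
  define \<gamma> where "\<gamma> = (\<epsilon> - \<delta>) / 2"
  have \<gamma>: "0 < \<gamma>" "\<delta> + \<gamma> < \<epsilon>"
    using \<delta>(1) by (auto simp: \<gamma>_def field_simps)
  obtain a where a: "a \<in> A" "u a \<le> \<gamma> *\<^sub>R y"
    using net_catching_element_scaleR[OF y \<gamma>(1)] u unfolding net_catching_element_def by blast
  have "w \<in> ?O" if "w \<in> {z - u a .. z + u a}" for w
  proof -
    have w: "w - z \<le> \<gamma> *\<^sub>R y" "z - w \<le> \<gamma> *\<^sub>R y"
      using that a(2) by (auto simp: algebra_simps intro: order_trans)
    have "w - l \<le> (\<delta> + \<gamma>) *\<^sub>R y" "- (w - l) \<le> (\<delta> + \<gamma>) *\<^sub>R y"
      using add_mono[OF \<delta>(2) w(1)] add_mono[OF \<delta>(3) w(2)] by (simp_all add: scaleR_add_left)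
    then show ?thesis
      using \<gamma>(2) by blast
  qed
  then show "\<exists>a\<in>A. {z - u a .. z + u a} \<subseteq> ?O"
    using a(1) by blast
qed

text \<open>Openness of \<open>U\<close> at \<open>l\<close> is tested directly on the dominating
  net \<open>y\<close>: some interval around \<open>l\<close> with radius \<open>y b\<close> lies in
  \<open>U\<close>, and beyond \<open>\<eta> b\<close> the net stays in that interval.\<close>

lemma order_converges_imp_limitin:
  assumes net: "directed_index A r" and conv: "order_converges A r x l"
  shows "limitin tau_o x l (tails A r)"
  unfolding limitin_def
proof (intro conjI allI impI)
  fix U assume "openin tau_o U \<and> l \<in> U"
  then have U: "net_catching_for U l"
    by (simp add: order_open_def)
  obtain B :: "'b set" and s y \<eta> where y: "decreases_to_zero B s y" "\<eta> ` B \<subseteq> A"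
    and bnd: "\<forall>b\<in>B. \<forall>a\<in>A. (\<eta> b, a) \<in> r \<longrightarrow> x a - l \<le> y b \<and> - (x a - l) \<le> y b"
    using conv unfolding order_converges_def by blast
  obtain b where b: "b \<in> B" "{l - y b .. l + y b} \<subseteq> U"
    using U y(1) unfolding net_catching_for_def by blast
  have "x a \<in> {l - y b .. l + y b}" if "a \<in> A" "(\<eta> b, a) \<in> r" for a
    using bnd b(1) that by (fastforce simp: algebra_simps)
  then show "\<forall>\<^sub>F a in tails A r. x a \<in> U"
    unfolding eventually_tails[OF net] using b y(2) by blast
qed simp

lemma limitin_imp_order_converges:
  fixes x :: "'i \<Rightarrow> 'a::ordered_real_vector"
  assumes archimedean: "\<forall>u v :: 'a. (\<forall>n::nat. real n *\<^sub>R u \<le> v) \<longrightarrow> u \<le> 0"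
    and y: "net_catching_element (y :: 'a)"
    and net: "directed_index A r"
    and lim: "limitin tau_o x l (tails A r)"
  shows "order_converges A r x l"
proof -
  have y0: "0 \<le> y"
    using y by (rule net_catching_element_nonneg)
  have "\<exists>a\<in>A. \<forall>b\<in>A. (a, b) \<in> r \<longrightarrow>
      x b - l \<le> y /\<^sub>R real (Suc n) \<and> - (x b - l) \<le> y /\<^sub>R real (Suc n)" for n
  proof -
    define \<epsilon> where "\<epsilon> = inverse (real (Suc n))"
    define U where "U = {z. \<exists>\<delta><\<epsilon>. z - l \<le> \<delta> *\<^sub>R y \<and> - (z - l) \<le> \<delta> *\<^sub>R y}"
    have "0 < \<epsilon>"
      by (simp add: \<epsilon>_def)
    \<comment> \<open>The witness \<delta> = 0 is admissible because \<epsilon> is positive.\<close>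
    then have "l \<in> U"
      by (auto simp: U_def intro: exI[of _ 0])
    moreover have "openin tau_o U"
      using order_open_ball[OF y] by (simp add: U_def)
    ultimately have "\<forall>\<^sub>F a in tails A r. x a \<in> U"
      using lim by (simp add: limitin_def)
    moreover have "z - l \<le> \<epsilon> *\<^sub>R y \<and> - (z - l) \<le> \<epsilon> *\<^sub>R y" if "z \<in> U" for z
    proof -
      obtain \<delta> where \<delta>: "\<delta> < \<epsilon>" "z - l \<le> \<delta> *\<^sub>R y" "- (z - l) \<le> \<delta> *\<^sub>R y"
        using \<open>z \<in> U\<close> unfolding U_def by blast
      \<comment> \<open>Since \<delta> may be any real below \<epsilon>, even a negative one, this
        comparison rests on the positivity of \<open>y\<close>.\<close>
      have "\<delta> *\<^sub>R y \<le> \<epsilon> *\<^sub>R y"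
        using \<delta>(1) y0 by (simp add: scaleR_right_mono)
      then show ?thesis
        using \<delta>(2,3) order_trans by blast
    qed
    ultimately show ?thesis
      unfolding eventually_tails[OF net] \<epsilon>_def by blast
  qed
  then obtain \<eta> where "\<And>n. \<eta> n \<in> A" "\<And>n b. b \<in> A \<Longrightarrow> (\<eta> n, b) \<in> r \<Longrightarrow>
      x b - l \<le> y /\<^sub>R real (Suc n) \<and> - (x b - l) \<le> y /\<^sub>R real (Suc n)"
    by metis
  \<comment> \<open>The dominating net is indexed by natural numbers, while
    \<open>order_converges\<close> wants indices in \<open>'a\<close>; replacing the net by its
    range bridges the two.\<close>
  then show ?thesis
    by (intro order_convergesI_any_index[OF decreases_to_zero_inverse_Suc[OF archimedean y0],
          of \<eta>]) blast+
qed

theorem corollary8p4: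
  fixes A :: "'i set" and r :: "'i rel"
    and x :: "'i \<Rightarrow> 'a::ordered_real_vector" and l :: 'a
  assumes archimedean: "\<forall>u v :: 'a. (\<forall>n::nat. real n *\<^sub>R u \<le> v) \<longrightarrow> u \<le> 0"
    and directed: "\<forall>u v :: 'a. \<exists>w. u \<le> w \<and> v \<le> w"
    and catching: "\<exists>y :: 'a. net_catching_element y"
    and net: "directed_index A r"
  shows "order_converges A r x l \<longleftrightarrow> limitin tau_o x l (tails A r)"
  using order_converges_imp_limitin[OF net] catching
    limitin_imp_order_converges[OF archimedean _ net] by blast

end
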